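(* Let $f : \mathbb{N} \to [0,1]$, and suppose $\mathbf{N} = (N_s)_{s \in \mathbb{N}}$ is a sequence with $\lim_{s \to \infty} N_s = \infty$ such that $f$ admits correlations along $\mathbf{N}$. Then there exists a decomposition $f = f_{\mathrm{inv}} + f_{\mathrm{erg}}$ such that: (i) $0 \leq f_{\mathrm{inv}} \leq 1$ and $\mathbb{E}_{n \in \mathbf{N}} f_{\mathrm{erg}}(n) = 0$; (ii) $f_{\mathrm{inv}}$ is locally invariant along $\mathbf{N}$; (iii) $f_{\mathrm{erg}}$ is locally ergodic along $\mathbf{N}$; (iv) $\langle f_{\mathrm{inv}}, f_{\mathrm{erg}}\rangle_{\mathbf{N}} = 0$.
   Context: Extend bounded functions on $\mathbb{N}$ to $\mathbb{Z}$ by setting them equal to $0$ on $\{\dots,-1,0\}$. A bounded $u\colon\mathbb{N}\to\mathbb{C}$ admits correlations along $\mathbf{N}$ if for every $k\ge 0$, $h_1,\dots,h_k\in\mathbb{Z}$ and $\omega_1,\dots,\omega_k\in\{0,1\}$ the limit $\lim_{s\to\infty}\frac{1}{N_s}\sum_{n=1}^{N_s}\prod_{i=1}^k C^{\omega_i}u(n+h_i)$ exists, where $C$ is complex conjugation. $\mathbb{E}_{n\in\mathbf{N}}a(n)=\lim_{s\to\infty}\frac{1}{N_s}\sum_{n=1}^{N_s}a(n)$, and $\langle f,g\rangle_{\mathbf{N}}=\mathbb{E}_{n\in\mathbf{N}}f(n)\overline{g(n)}$. A bounded $g$ is locally invariant along $\mathbf{N}$ if $\limsup_{s}\frac{1}{N_s}\sum_{n=1}^{N_s}|g(n+1)-g(n)|=0$,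 and locally ergodic along $\mathbf{N}$ if $\limsup_{H \to \infty} \limsup_{s \to \infty} \frac{1}{N_s} \sum_{n=1}^{N_s} | \frac{1}{H} \sum_{h=1}^H g(n+h)| = 0$. *)

theory Defs
  imports "HOL-Analysis.Analysis"
begin

text \<open>The positive integers are the values \<open>n \<ge> 1\<close> of type \<^typ>\<open>nat\<close>; the value of a
  function at \<open>0\<close> is junk and is never used. \<open>zext\<close> is the extension by \<open>0\<close> to the integers.\<close>

definition zext :: "(nat \<Rightarrow> complex) \<Rightarrow> int \<Rightarrow> complex" where
  "zext u k = (if k \<ge> 1 then u (nat k) else 0)"

definition bounded_seq :: "(nat \<Rightarrow> complex) \<Rightarrow> bool" where
  "bounded_seq u \<longleftrightarrow> bounded (u ` {1..})"

definition avg :: "nat \<Rightarrow> (nat \<Rightarrow> 'a::real_normed_field) \<Rightarrow> 'a" where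
  "avg M a = (1 / of_nat M) * (\<Sum>n=1..M. a n)"

text \<open>In the correlations, \<open>cnj ^^ \<omega> i\<close> is complex conjugation if \<open>\<omega> i = 1\<close> and the identity if
  \<open>\<omega> i = 0\<close>.\<close>

definition admits_correlations :: "(nat \<Rightarrow> nat) \<Rightarrow> (nat \<Rightarrow> complex) \<Rightarrow> bool" where
  "admits_correlations N u \<longleftrightarrow> bounded_seq u \<and>
     (\<forall>(k::nat) (h::nat \<Rightarrow> int) (\<omega>::nat \<Rightarrow> nat). (\<forall>i\<in>{1..k}. \<omega> i \<in> {0, 1}) \<longrightarrow>
        convergent (\<lambda>s. avg (N s) (\<lambda>n. \<Prod>i=1..k. (cnj ^^ \<omega> i) (zext u (int n + h i)))))"

text \<open>Means and inner products along \<open>N\<close> are limits that need not exist, so they are rendered as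
  relations asserting both existence and value.\<close>

definition has_mean_along :: "(nat \<Rightarrow> nat) \<Rightarrow> (nat \<Rightarrow> complex) \<Rightarrow> complex \<Rightarrow> bool" where
  "has_mean_along N a c \<longleftrightarrow> (\<lambda>s. avg (N s) a) \<longlonglongrightarrow> c"

definition has_inner_along ::
    "(nat \<Rightarrow> nat) \<Rightarrow> (nat \<Rightarrow> complex) \<Rightarrow> (nat \<Rightarrow> complex) \<Rightarrow> complex \<Rightarrow> bool" where
  "has_inner_along N f g c \<longleftrightarrow> has_mean_along N (\<lambda>n. f n * cnj (g n)) c"

definition locally_invariant :: "(nat \<Rightarrow> nat) \<Rightarrow> (nat \<Rightarrow> complex) \<Rightarrow> bool" where
  "locally_invariant N g \<longleftrightarrow> bounded_seq g \<and>
     limsup (\<lambda>s. ereal (avg (N s) (\<lambda>n. cmod (g (n + 1) - g n)))) = 0"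

definition locally_ergodic :: "(nat \<Rightarrow> nat) \<Rightarrow> (nat \<Rightarrow> complex) \<Rightarrow> bool" where
  "locally_ergodic N g \<longleftrightarrow> bounded_seq g \<and>
     limsup (\<lambda>H. limsup (\<lambda>s.
       ereal (avg (N s) (\<lambda>n. cmod (avg H (\<lambda>h. g (n + h))))))) = 0"

end

theory Submission
  imports Defs
begin

text \<open>The averages \<open>A\<^sub>H f(n) = (1/H) (f(n + 1) + \<dots> + f(n + H))\<close> are Cauchy in mean along \<open>N\<close>, by von
  Neumann's proof of the mean ergodic theorem; this only needs the correlations of order two. Their
  limit \<open>f_inv\<close> is \<open>A\<^sub>H f(n)\<close> with \<open>H = H(n)\<close> growing slowly. It is locally invariant because each
  \<open>A\<^sub>H f\<close> is \<open>2/H\<close>-invariant, and \<open>f_erg = f - f_inv\<close> is locally ergodic because \<open>A\<^sub>H f_inv\<close> stays close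
  to \<open>f_inv\<close>. The mean of an invariant \<open>g\<close> times an ergodic \<open>e\<close> vanishes, as \<open>e\<close> may be replaced by
  \<open>A\<^sub>H e\<close>; this gives the orthogonality, and with \<open>g = 1\<close> the zero mean.\<close>

section \<open>Finite averages and their behaviour under shifts\<close>

lemma avg_add: "avg M (\<lambda>n. a n + b n) = avg M a + avg M b"
  by (simp add: avg_def sum.distrib algebra_simps)

lemma avg_diff: "avg M (\<lambda>n. a n - b n) = avg M a - avg M b"
  by (simp add: avg_def sum_subtractf algebra_simps)

lemma avg_cmult: "avg M (\<lambda>n. c * a n) = c * avg M a"
  by (simp add: avg_def flip: sum_distrib_left)

lemma avg_mult_const: "avg M (\<lambda>n. a n * c) = avg M a * c"
  by (simp add: avg_def flip: sum_distrib_right)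

lemma avg_const: "M > 0 \<Longrightarrow> avg M (\<lambda>n. c) = c"
  by (simp add: avg_def)

lemma avg_cong: "(\<And>n. n \<ge> 1 \<Longrightarrow> a n = b n) \<Longrightarrow> avg M a = avg M b"
  by (simp add: avg_def)

lemma avg_mono:
  fixes a b :: "nat \<Rightarrow> real"
  assumes "\<And>n. n \<ge> 1 \<Longrightarrow> n \<le> M \<Longrightarrow> a n \<le> b n"
  shows "avg M a \<le> avg M b"
  unfolding avg_def by (intro mult_left_mono sum_mono) (auto intro: assms)

lemma avg_nonneg:
  fixes a :: "nat \<Rightarrow> real"
  assumes "\<And>n. n \<ge> 1 \<Longrightarrow> 0 \<le> a n"
  shows "0 \<le> avg M a"
  unfolding avg_def by (intro mult_nonneg_nonneg sum_nonneg) (auto intro: assms)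

lemma avg_le_const:
  fixes a :: "nat \<Rightarrow> real"
  assumes "\<And>n. n \<ge> 1 \<Longrightarrow> n \<le> M \<Longrightarrow> a n \<le> c" "M > 0"
  shows "avg M a \<le> c"
  using avg_mono[of M a "\<lambda>_. c"] assms by (simp add: avg_const)

text \<open>The empty average is \<open>0\<close>, since division by zero gives \<open>0\<close>;
  hence the bound also covers \<open>M = 0\<close>.\<close>

lemma avg_le_one:
  fixes a :: "nat \<Rightarrow> real"
  assumes "\<And>n. a n \<le> 1"
  shows "avg M a \<le> 1"
  using assms by (cases "M = 0") (auto simp: avg_def[of 0] intro!: avg_le_const)

lemma abs_avg_le:
  fixes a :: "nat \<Rightarrow> real"
  shows "\<bar>avg M a\<bar> \<le> avg M (\<lambda>n. \<bar>a n\<bar>)"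
  by (simp add: avg_def abs_mult mult_left_mono divide_right_mono)

lemma avg_swap: "avg M (\<lambda>n. avg H (\<lambda>h. F n h)) = avg H (\<lambda>h. avg M (\<lambda>n. F n h))"
proof -
  have "(\<Sum>n=1..M. \<Sum>h=1..H. F n h) = (\<Sum>h=1..H. \<Sum>n=1..M. F n h)"
    by (rule sum.swap)
  then show ?thesis
    by (simp add: avg_def flip: sum_distrib_left sum_divide_distrib)
qed

lemma avg_of_real: "avg M (\<lambda>n. of_real (a n)) = of_real (avg M a)"
  by (simp add: avg_def)

lemma tendsto_avg:
  assumes "\<And>h. h \<ge> 1 \<Longrightarrow> ((\<lambda>s. F s h) \<longlongrightarrow> c h) L"
  shows "((\<lambda>s. avg H (F s)) \<longlongrightarrow> avg H c) L"
  unfolding avg_def by (intro tendsto_intros assms) auto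

lemma convergent_avg:
  assumes "\<And>h. h \<ge> 1 \<Longrightarrow> convergent (\<lambda>s. F s h)"
  shows "convergent (\<lambda>s. avg H (F s))"
proof -
  have "((\<lambda>s. F s h) \<longlongrightarrow> lim (\<lambda>s. F s h)) sequentially" if "h \<ge> 1" for h
    using assms[OF that] by (simp add: convergent_LIMSEQ_iff)
  then have "(\<lambda>s. avg H (F s)) \<longlonglongrightarrow> avg H (\<lambda>h. lim (\<lambda>s. F s h))"
    by (rule tendsto_avg)
  then show ?thesis
    by (rule convergentI)
qed

text \<open>The variance of \<open>a\<close> over \<open>1..H\<close> is nonnegative.\<close>

lemma avg_square_le:
  fixes a :: "nat \<Rightarrow> real"
  assumes "H > 0"
  shows "(avg H a)\<^sup>2 \<le> avg H (\<lambda>h. (a h)\<^sup>2)"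
proof -
  define m where "m = avg H a"
  have "0 \<le> avg H (\<lambda>h. (a h - m)\<^sup>2)"
    by (rule avg_nonneg) simp
  also have "(\<lambda>h. (a h - m)\<^sup>2) = (\<lambda>h. ((a h)\<^sup>2 - (2 * m) * a h) + m\<^sup>2)"
    by (auto simp: power2_eq_square algebra_simps)
  also have "avg H \<dots> = avg H (\<lambda>h. (a h)\<^sup>2) - 2 * m * m + m\<^sup>2"
    by (simp only: avg_add avg_diff avg_cmult avg_const[OF assms] m_def)
  finally show ?thesis
    by (simp add: m_def power2_eq_square)
qed

text \<open>Raising the shift by one changes the sum only at its two ends, by at most
  \<open>2 * B\<close>; this happens \<open>k\<close> times.\<close>

lemma abs_avg_shift_le:
  fixes a :: "nat \<Rightarrow> real"
  assumes "\<And>n. \<bar>a n\<bar> \<le> B"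
  shows "\<bar>avg M (\<lambda>n. a (n + k)) - avg M a\<bar> \<le> real k * (2 * B) / real M"
proof (induction k)
  case 0
  then show ?case by simp
next
  case (Suc k)
  have "(\<Sum>n=1..M. a (n + Suc k)) - (\<Sum>n=1..M. a (n + k)) = a (M + Suc k) - a (Suc k)"
    by (induction M) auto
  then have "avg M (\<lambda>n. a (n + Suc k)) - avg M (\<lambda>n. a (n + k)) = (a (M + Suc k) - a (Suc k)) / real M"
    by (simp add: avg_def flip: diff_divide_distrib)
  moreover have "\<bar>a (M + Suc k) - a (Suc k)\<bar> \<le> 2 * B"
    using assms[of "M + Suc k"] assms[of "Suc k"] by linarith
  ultimately have "\<bar>avg M (\<lambda>n. a (n + Suc k)) - avg M (\<lambda>n. a (n + k))\<bar> \<le> 2 * B / real M"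
    by (simp add: abs_divide divide_right_mono)
  with Suc have "\<bar>avg M (\<lambda>n. a (n + Suc k)) - avg M a\<bar> \<le> 2 * B / real M + real k * (2 * B) / real M"
    by linarith
  then show ?case
    by (simp add: algebra_simps add_divide_distrib)
qed

lemma tendsto_0_if_eventually_less:
  fixes u :: "nat \<Rightarrow> real"
  assumes "\<And>\<epsilon>. \<epsilon> > 0 \<Longrightarrow> \<forall>\<^sub>F s in sequentially. \<bar>u s\<bar> < \<epsilon>"
  shows "u \<longlonglongrightarrow> 0"
  using assms by (simp add: tendsto_iff dist_real_def)

lemma eventually_abs_less:
  fixes u :: "nat \<Rightarrow> real"
  assumes "u \<longlonglongrightarrow> 0" "\<epsilon> > 0"
  shows "\<forall>\<^sub>F s in sequentially. \<bar>u s\<bar> < \<epsilon>"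
  using assms by (simp add: tendsto_iff dist_real_def)

text \<open>The boundary terms are negligible because \<open>N s\<close> tends to infinity. Stating
  this for differences covers bounded sequences whose mean along \<open>N\<close> does not
  exist.\<close>

lemma avg_shift_tendsto_0:
  fixes a :: "nat \<Rightarrow> real"
  assumes N: "filterlim N at_top sequentially" and B: "\<And>n. \<bar>a n\<bar> \<le> B"
  shows "(\<lambda>s. avg (N s) (\<lambda>n. a (n + k)) - avg (N s) a) \<longlonglongrightarrow> 0"
proof (rule Lim_null_comparison)
  show "\<forall>\<^sub>F s in sequentially. norm (avg (N s) (\<lambda>n. a (n + k)) - avg (N s) a)
          \<le> real k * (2 * B) / real (N s)"
    using abs_avg_shift_le[of a, OF B] by simp
  have "((\<lambda>m. real k * (2 * B) / real m) \<longlongrightarrow> 0) sequentially"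
    by (rule lim_const_over_n)
  then show "((\<lambda>s. real k * (2 * B) / real (N s)) \<longlongrightarrow> 0) sequentially"
    using N by (rule filterlim_compose)
qed

text \<open>Allows a bounded sequence under a mean along \<open>N\<close> to be replaced by its
  averages over windows of fixed length \<open>H\<close>.\<close>

lemma avg_avg_shift_tendsto_0:
  fixes a :: "nat \<Rightarrow> real"
  assumes N: "filterlim N at_top sequentially" and B: "\<And>n. \<bar>a n\<bar> \<le> B" and H: "H > 0"
  shows "(\<lambda>s. avg (N s) (\<lambda>n. avg H (\<lambda>h. a (n + h))) - avg (N s) a) \<longlonglongrightarrow> 0"
proof -
  have "(\<lambda>s. avg H (\<lambda>h. avg (N s) (\<lambda>n. a (n + h)) - avg (N s) a)) \<longlonglongrightarrow> avg H (\<lambda>h. 0)"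
    by (intro tendsto_avg avg_shift_tendsto_0[OF N B])
  then show ?thesis
    by (simp add: avg_diff avg_const[OF H] avg_swap[of _ H])
qed

subsection \<open>The mean ergodic theorem\<close>

text \<open>After the interchange of averages, the inner average is a mean over
  \<open>k \<le> i\<close> of window averages shifted by \<open>k\<close>, and each such shift costs
  at most \<open>2 * k / H\<close>. So for \<open>H\<close> much larger than \<open>i\<close>,
  averaging at scale \<open>i\<close> first hardly affects the average at scale \<open>H\<close>,
  uniformly in \<open>n\<close>.\<close>

lemma abs_diff_avg_shifted_avg_le:
  fixes f :: "nat \<Rightarrow> real"
  assumes f: "\<And>n. 0 \<le> f n" "\<And>n. f n \<le> 1" and i: "i > 0"
  shows "\<bar>avg H (\<lambda>h. f (n + h)) - avg H (\<lambda>h. avg i (\<lambda>k. f (n + h + k)))\<bar> \<le> 2 * real i / real H"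
proof -
  have *: "\<bar>avg H (\<lambda>h. f (n + h)) - avg H (\<lambda>h. f (n + h + k))\<bar> \<le> 2 * real i / real H" if "k \<le> i" for k
  proof -
    have "\<bar>avg H (\<lambda>h. f (n + (h + k))) - avg H (\<lambda>h. f (n + h))\<bar> \<le> real k * (2 * 1) / real H"
      using f by (intro abs_avg_shift_le[of "\<lambda>h. f (n + h)" 1 H k]) auto
    also have "\<dots> \<le> 2 * real i / real H"
      using that by (intro divide_right_mono) auto
    finally show ?thesis
      by (simp add: abs_minus_commute add.assoc)
  qed
  have "avg H (\<lambda>h. f (n + h)) - avg H (\<lambda>h. avg i (\<lambda>k. f (n + h + k)))
      = avg i (\<lambda>k. avg H (\<lambda>h. f (n + h)) - avg H (\<lambda>h. f (n + h + k)))"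
    by (simp add: avg_diff avg_const[OF i] avg_swap[of H i])
  also have "\<bar>\<dots>\<bar> \<le> avg i (\<lambda>k. \<bar>avg H (\<lambda>h. f (n + h)) - avg H (\<lambda>h. f (n + h + k))\<bar>)"
    by (rule abs_avg_le)
  also have "\<dots> \<le> 2 * real i / real H"
    using i * by (intro avg_le_const) auto
  finally show ?thesis .
qed

lemma square_le_add_diff:
  fixes x y :: real
  assumes "0 \<le> x" "x \<le> 1" "0 \<le> y" "y \<le> 1" "\<bar>x - y\<bar> \<le> d"
  shows "x\<^sup>2 \<le> y\<^sup>2 + 2 * d"
proof -
  have "x\<^sup>2 - y\<^sup>2 = (x - y) * (x + y)"
    by (simp add: power2_eq_square algebra_simps)
  also have "\<dots> \<le> d * 2"
    using assms by (intro mult_mono) auto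
  finally show ?thesis by simp
qed

text \<open>Expanding the product gives a finite double average of correlations of order
  two.\<close>

lemma convergent_avg_mult_avg:
  fixes f :: "nat \<Rightarrow> real"
  assumes "\<And>a b. convergent (\<lambda>s. avg (N s) (\<lambda>n. f (n + a) * f (n + b)))"
  shows "convergent (\<lambda>s. avg (N s) (\<lambda>n. avg i (\<lambda>h. f (n + h)) * avg j (\<lambda>h. f (n + h))))"
proof -
  have "convergent (\<lambda>s. avg i (\<lambda>h. avg j (\<lambda>k. avg (N s) (\<lambda>n. f (n + h) * f (n + k)))))"
    by (intro convergent_avg assms)
  moreover have "avg i (\<lambda>h. avg j (\<lambda>k. avg M (\<lambda>n. f (n + h) * f (n + k))))
      = avg M (\<lambda>n. avg i (\<lambda>h. f (n + h)) * avg j (\<lambda>h. f (n + h)))" for M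
    by (simp add: avg_swap[of _ M] avg_cmult avg_mult_const)
  ultimately show ?thesis by simp
qed

text \<open>Von Neumann's argument: the mean square of a convex combination of shifts of \<open>f\<close> cannot be
  much smaller than that of a long average, so the long averages have nearly minimal mean square,
  and so have their midpoints; the parallelogram law then forces them to be close.\<close>

lemma shifted_avg_Cauchy_in_mean_square:
  fixes f :: "nat \<Rightarrow> real"
  defines "A \<equiv> \<lambda>H n. avg H (\<lambda>h. f (n + h))"
  assumes N: "filterlim N at_top sequentially"
    and f: "\<And>n. 0 \<le> f n" "\<And>n. f n \<le> 1"
    and conv: "\<And>a b. convergent (\<lambda>s. avg (N s) (\<lambda>n. f (n + a) * f (n + b)))"
    and \<epsilon>: "\<epsilon> > 0"
  shows "\<exists>J>0. \<forall>i\<ge>J. \<forall>j\<ge>J. \<forall>\<^sub>F s in sequentially. avg (N s) (\<lambda>n. (A i n - A j n)\<^sup>2) < \<epsilon>"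
proof -
  \<comment> \<open>Midpoints of two averages. Since \<open>g i i = A i\<close>, this one family
    contains the averages themselves as well.\<close>
  define g where "g = (\<lambda>i j n. (A i n + A j n) / 2)"
  have "\<exists>p. \<forall>i j. (\<lambda>s. avg (N s) (\<lambda>n. A i n * A j n)) \<longlonglongrightarrow> p i j"
    using convergent_avg_mult_avg[OF conv] unfolding A_def convergent_def by metis
  then obtain p where p: "\<And>i j. (\<lambda>s. avg (N s) (\<lambda>n. A i n * A j n)) \<longlonglongrightarrow> p i j"
    by blast
  \<comment> \<open>The limiting mean square of \<open>g i j\<close>, expanded through the limiting
    inner products \<open>p\<close>.\<close>
  define q where "q = (\<lambda>i j. (p i i + 2 * p i j + p j j) / 4)"
  have gsq: "avg M (\<lambda>n. (g i j n)\<^sup>2)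
      = (avg M (\<lambda>n. A i n * A i n) + 2 * avg M (\<lambda>n. A i n * A j n) + avg M (\<lambda>n. A j n * A j n)) / 4" for M i j
  proof -
    have "(\<lambda>n. (g i j n)\<^sup>2) = (\<lambda>n. (1/4) * (A i n * A i n + 2 * (A i n * A j n) + A j n * A j n))"
      by (auto simp: g_def power2_eq_square algebra_simps)
    then show ?thesis
      by (simp only: avg_add avg_cmult)
  qed
  have q: "(\<lambda>s. avg (N s) (\<lambda>n. (g i j n)\<^sup>2)) \<longlonglongrightarrow> q i j" for i j
    unfolding gsq q_def by (intro tendsto_intros p) auto
  have A01: "0 \<le> A i n" "A i n \<le> 1" for i n
  proof -
    show "0 \<le> A i n"
      unfolding A_def using f by (intro avg_nonneg) auto
    show "A i n \<le> 1"
      unfolding A_def using f by (intro avg_le_one) auto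
  qed
  have g01: "0 \<le> g i j n" "g i j n \<le> 1" for i j n
    using A01[of i n] A01[of j n] by (auto simp: g_def)
  \<comment> \<open>The bound is half the sum of the errors \<open>2 * i / H\<close> and
    \<open>2 * j / H\<close> for the two ends of the midpoint.\<close>
  have gdiff: "\<bar>A H n - avg H (\<lambda>h. g i j (n + h))\<bar> \<le> (real i + real j) / real H"
    if "i > 0" "j > 0" "H > 0" for i j H n
  proof -
    have "2 * avg H (\<lambda>h. g i j (n + h)) = avg H (\<lambda>h. A i (n + h)) + avg H (\<lambda>h. A j (n + h))"
      unfolding g_def avg_add[symmetric] avg_cmult[symmetric] by (simp add: add_divide_distrib)
    moreover have "\<bar>A H n - avg H (\<lambda>h. A i (n + h))\<bar> \<le> 2 * (real i / real H)"
        "\<bar>A H n - avg H (\<lambda>h. A j (n + h))\<bar> \<le> 2 * (real j / real H)"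
      unfolding A_def times_divide_eq_right using that by (auto intro!: abs_diff_avg_shifted_avg_le f)
    ultimately have "\<bar>A H n - avg H (\<lambda>h. g i j (n + h))\<bar> \<le> real i / real H + real j / real H"
      by linarith
    then show ?thesis
      by (simp add: add_divide_distrib)
  qed
  \<comment> \<open>By \<open>gdiff\<close>, \<open>A H\<close> is close to the window average of
    \<open>g i j\<close>; Cauchy-Schwarz moves the square inside that average, and shift invariance
    of the mean then removes the average. The factor \<open>2\<close> is the Lipschitz constant of
    squaring on the unit interval.\<close>
  have key: "q H H \<le> q i j + 2 * ((real i + real j) / real H)"
    if "i > 0" "j > 0" "H > 0" for i j H
  proof (rule LIMSEQ_le)
    show "(\<lambda>s. avg (N s) (\<lambda>n. (g H H n)\<^sup>2)) \<longlonglongrightarrow> q H H" by (rule q)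
    have "(\<lambda>s. (avg (N s) (\<lambda>n. avg H (\<lambda>h. (g i j (n + h))\<^sup>2)) - avg (N s) (\<lambda>n. (g i j n)\<^sup>2))
        + avg (N s) (\<lambda>n. (g i j n)\<^sup>2) + 2 * ((real i + real j) / real H))
        \<longlonglongrightarrow> 0 + q i j + 2 * ((real i + real j) / real H)"
      using g01 that
      by (intro tendsto_add q tendsto_const avg_avg_shift_tendsto_0[OF N, of "\<lambda>n. (g i j n)\<^sup>2" 1])
        (auto simp: power_le_one)
    then show "(\<lambda>s. avg (N s) (\<lambda>n. avg H (\<lambda>h. (g i j (n + h))\<^sup>2)) + 2 * ((real i + real j) / real H))
        \<longlonglongrightarrow> q i j + 2 * ((real i + real j) / real H)"
      by simp
    show "\<exists>s0. \<forall>s\<ge>s0. avg (N s) (\<lambda>n. (g H H n)\<^sup>2)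
        \<le> avg (N s) (\<lambda>n. avg H (\<lambda>h. (g i j (n + h))\<^sup>2)) + 2 * ((real i + real j) / real H)"
    proof -
      have "(g H H n)\<^sup>2 \<le> avg H (\<lambda>h. (g i j (n + h))\<^sup>2) + 2 * ((real i + real j) / real H)" for n
      proof -
        have "(g H H n)\<^sup>2 = (A H n)\<^sup>2" by (simp add: g_def)
        also have "\<dots> \<le> (avg H (\<lambda>h. g i j (n + h)))\<^sup>2 + 2 * ((real i + real j) / real H)"
          using that g01 A01
          by (intro square_le_add_diff gdiff) (auto intro!: avg_nonneg avg_le_const)
        also have "(avg H (\<lambda>h. g i j (n + h)))\<^sup>2 \<le> avg H (\<lambda>h. (g i j (n + h))\<^sup>2)"
          using that by (intro avg_square_le)
        finally show ?thesis by simp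
      qed
      then have "avg M (\<lambda>n. (g H H n)\<^sup>2)
          \<le> avg M (\<lambda>n. avg H (\<lambda>h. (g i j (n + h))\<^sup>2) + 2 * ((real i + real j) / real H))" for M
        by (intro avg_mono)
      \<comment> \<open>Only an inequality, because for \<open>M = 0\<close> the constant averages
        to \<open>0\<close>.\<close>
      also have "avg M (\<lambda>n. avg H (\<lambda>h. (g i j (n + h))\<^sup>2) + 2 * ((real i + real j) / real H))
          \<le> avg M (\<lambda>n. avg H (\<lambda>h. (g i j (n + h))\<^sup>2)) + 2 * ((real i + real j) / real H)" for M
        by (cases "M = 0") (simp_all add: avg_add avg_const, simp add: avg_def)
      finally show ?thesis by blast
    qed
  qed
  \<comment> \<open>The infimum \<open>d\<close> plays the role of the minimal squared norm in a
    convex set. Index \<open>0\<close> is excluded because \<open>A 0 = 0\<close> would force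
    \<open>d = 0\<close>.\<close>
  define S where "S = {q i j | i j. i > 0 \<and> j > 0}"
  define d where "d = Inf S"
  have q0: "0 \<le> q i j" for i j
    using q[of i j] by (rule LIMSEQ_le_const) (auto intro!: avg_nonneg)
  have S: "bdd_below S" "S \<noteq> {}"
    by (auto simp: S_def intro!: bdd_belowI[of _ 0] q0)
  have d_le: "d \<le> q i j" if "i > 0" "j > 0" for i j
    unfolding d_def using S that by (intro cInf_lower) (auto simp: S_def)
  have "\<exists>x\<in>S. x < d + \<epsilon> / 16"
    using cInf_lessD[of S "d + \<epsilon> / 16"] S \<epsilon> by (auto simp: d_def)
  then obtain i0 j0 where ij0: "i0 > 0" "j0 > 0" "q i0 j0 < d + \<epsilon> / 16"
    by (auto simp: S_def)
  \<comment> \<open>For the fixed, nearly minimizing pair \<open>i0\<close>, \<open>j0\<close>, the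
    error in \<open>key\<close> vanishes as \<open>H\<close> grows. Two errors of
    \<open>\<epsilon> / 16\<close> place \<open>q H H\<close> below
    \<open>d + \<epsilon> / 8\<close>.\<close>
  have "(\<lambda>H. (2 * (real i0 + real j0)) / real H) \<longlonglongrightarrow> 0"
    by (rule lim_const_over_n)
  then have "\<forall>\<^sub>F H in sequentially. \<bar>(2 * (real i0 + real j0)) / real H\<bar> < \<epsilon> / 16"
    using \<epsilon> by (intro eventually_abs_less) auto
  then obtain J0 where J0: "\<And>H. H \<ge> J0 \<Longrightarrow> \<bar>(2 * (real i0 + real j0)) / real H\<bar> < \<epsilon> / 16"
    by (auto simp: eventually_sequentially)
  have small: "q H H < d + \<epsilon> / 8" if "H \<ge> Suc J0" for H
  proof -
    have "q H H \<le> q i0 j0 + (2 * (real i0 + real j0)) / real H"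
      using key[OF ij0(1,2), of H] that by simp
    also have "\<dots> < (d + \<epsilon> / 16) + \<epsilon> / 16"
      using J0[of H] ij0(3) that by (intro add_strict_mono) auto
    finally show ?thesis by simp
  qed
  show ?thesis
  proof (intro exI[of _ "Suc J0"] conjI allI impI)
    fix i j assume ij: "i \<ge> Suc J0" "j \<ge> Suc J0"
    \<comment> \<open>The parallelogram law for \<open>A i = g i i\<close> and
      \<open>A j = g j j\<close>.\<close>
    have "avg M (\<lambda>n. (A i n - A j n)\<^sup>2) = 2 * avg M (\<lambda>n. (g i i n)\<^sup>2) + 2 * avg M (\<lambda>n. (g j j n)\<^sup>2)
        - 4 * avg M (\<lambda>n. (g i j n)\<^sup>2)" for M
    proof -
      have "(\<lambda>n. (A i n - A j n)\<^sup>2) = (\<lambda>n. 2 * (g i i n)\<^sup>2 + 2 * (g j j n)\<^sup>2 - 4 * (g i j n)\<^sup>2)"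
        by (auto simp: g_def power2_eq_square field_simps)
      then show ?thesis
        by (simp only: avg_add avg_diff avg_cmult)
    qed
    moreover have "(\<lambda>s. 2 * avg (N s) (\<lambda>n. (g i i n)\<^sup>2) + 2 * avg (N s) (\<lambda>n. (g j j n)\<^sup>2)
        - 4 * avg (N s) (\<lambda>n. (g i j n)\<^sup>2)) \<longlonglongrightarrow> 2 * q i i + 2 * q j j - 4 * q i j"
      by (intro tendsto_intros q)
    ultimately have lim: "(\<lambda>s. avg (N s) (\<lambda>n. (A i n - A j n)\<^sup>2)) \<longlonglongrightarrow> 2 * q i i + 2 * q j j - 4 * q i j"
      by simp
    \<comment> \<open>The midpoint contributes at least \<open>d\<close>, so the terms in
      \<open>d\<close> cancel and at most \<open>\<epsilon> / 2\<close> is left.\<close>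
    have "2 * q i i + 2 * q j j - 4 * q i j < \<epsilon>"
      using small[of i] small[of j] d_le[of i j] ij \<epsilon> by simp
    with lim show "\<forall>\<^sub>F s in sequentially. avg (N s) (\<lambda>n. (A i n - A j n)\<^sup>2) < \<epsilon>"
      by (rule order_tendstoD)
  qed simp
qed

text \<open>Passes from mean squares to mean absolute values by Cauchy-Schwarz.\<close>

lemma shifted_avg_Cauchy_in_mean:
  fixes f :: "nat \<Rightarrow> real"
  defines "A \<equiv> \<lambda>H n. avg H (\<lambda>h. f (n + h))"
  assumes N: "filterlim N at_top sequentially"
    and f: "\<And>n. 0 \<le> f n" "\<And>n. f n \<le> 1"
    and conv: "\<And>a b. convergent (\<lambda>s. avg (N s) (\<lambda>n. f (n + a) * f (n + b)))"
    and \<epsilon>: "\<epsilon> > 0"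
  shows "\<exists>J>0. \<forall>i\<ge>J. \<forall>j\<ge>J. \<forall>\<^sub>F s in sequentially. avg (N s) (\<lambda>n. \<bar>A i n - A j n\<bar>) < \<epsilon>"
proof -
  obtain J where J: "J > 0" "\<And>i j. i \<ge> J \<Longrightarrow> j \<ge> J \<Longrightarrow>
      \<forall>\<^sub>F s in sequentially. avg (N s) (\<lambda>n. (A i n - A j n)\<^sup>2) < \<epsilon>\<^sup>2 / 4"
    using shifted_avg_Cauchy_in_mean_square[OF N f conv, of "\<epsilon>\<^sup>2 / 4"] \<epsilon> unfolding A_def by auto
  show ?thesis
  proof (intro exI[of _ J] conjI allI impI J(1))
    fix i j assume "i \<ge> J" "j \<ge> J"
    from J(2)[OF this]
    show "\<forall>\<^sub>F s in sequentially. avg (N s) (\<lambda>n. \<bar>A i n - A j n\<bar>) < \<epsilon>"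
    proof eventually_elim
      case (elim s)
      have "(avg (N s) (\<lambda>n. \<bar>A i n - A j n\<bar>))\<^sup>2 \<le> avg (N s) (\<lambda>n. \<bar>A i n - A j n\<bar>\<^sup>2)"
        by (cases "N s = 0") (simp add: avg_def, simp only: avg_square_le)
      also have "\<dots> < \<epsilon>\<^sup>2"
        using elim zero_less_power[OF \<epsilon>, of 2] unfolding power2_abs by linarith
      finally show ?case
        using \<epsilon> by (simp add: power2_less_imp_less)
    qed
  qed
qed

subsection \<open>Completeness\<close>

text \<open>As \<open>N\<close> may fail to be monotone, the finitely many early \<open>s\<close>
  are excluded by a threshold above the sum of their values \<open>N s\<close>. Conditions on the
  size of \<open>N s\<close> can then be compared with the block ends in the next
  construction.\<close>

lemma eventually_sequentially_imp_of_large_values: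
  fixes N :: "nat \<Rightarrow> nat"
  assumes "\<forall>\<^sub>F s in sequentially. Q s"
  shows "\<exists>P. \<forall>s. N s \<ge> P \<longrightarrow> Q s"
proof -
  obtain s0 where s0: "\<And>s. s \<ge> s0 \<Longrightarrow> Q s"
    using assms by (auto simp: eventually_sequentially)
  have "N s \<le> (\<Sum>t<s0. N t)" if "s < s0" for s
    using that by (intro member_le_sum) auto
  then have "\<forall>s. N s \<ge> Suc (\<Sum>t<s0. N t) \<longrightarrow> Q s"
    using s0 by (meson not_less not_less_eq_eq)
  then show ?thesis by blast
qed

text \<open>The limit follows the \<open>k\<close>-th member of a fast Cauchy subsequence on a block \<open>[M k, M (k + 1))\<close>.
  As \<open>M k \<ge> k * M (k - 1)\<close>, at any scale all but the last two blocks are negligible.\<close>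

lemma complete_in_mean:
  fixes F :: "nat \<Rightarrow> nat \<Rightarrow> real"
  assumes N: "filterlim N at_top sequentially"
    and F: "\<And>j n. 0 \<le> F j n" "\<And>j n. F j n \<le> 1"
    and Cauchy: "\<And>\<epsilon>. \<epsilon> > 0 \<Longrightarrow>
      \<exists>J. \<forall>i\<ge>J. \<forall>j\<ge>J. \<forall>\<^sub>F s in sequentially. avg (N s) (\<lambda>n. \<bar>F i n - F j n\<bar>) < \<epsilon>"
  shows "\<exists>G. (\<forall>n. 0 \<le> G n \<and> G n \<le> 1) \<and>
    (\<forall>\<epsilon>>0. \<exists>J. \<forall>j\<ge>J. \<forall>\<^sub>F s in sequentially. avg (N s) (\<lambda>n. \<bar>G n - F j n\<bar>) < \<epsilon>)"
proof -
  define \<delta> where "\<delta> = (\<lambda>k. 1 / real (Suc k))"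
  have \<delta>: "\<delta> k > 0" for k by (simp add: \<delta>_def)
  have "\<forall>k. \<exists>J. \<forall>i\<ge>J. \<forall>j\<ge>J. \<forall>\<^sub>F s in sequentially. avg (N s) (\<lambda>n. \<bar>F i n - F j n\<bar>) < \<delta> k"
    using Cauchy \<delta> by blast
  then obtain J0 where J0: "\<And>k i j. i \<ge> J0 k \<Longrightarrow> j \<ge> J0 k \<Longrightarrow>
      \<forall>\<^sub>F s in sequentially. avg (N s) (\<lambda>n. \<bar>F i n - F j n\<bar>) < \<delta> k"
    by metis
  \<comment> \<open>The sum dominates every \<open>J0 k\<close> with \<open>k \<le> l\<close>, so
    \<open>J l\<close> serves all the tolerances \<open>\<delta> 0\<close>, ...,
    \<open>\<delta> l\<close> at once.\<close>
  define J where "J = (\<lambda>k. \<Sum>i\<le>k. J0 i)"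
  have J: "J0 k \<le> J l" if "k \<le> l" for k l
    unfolding J_def using that by (intro member_le_sum) auto
  have "\<forall>l. \<exists>P. \<forall>s. N s \<ge> P \<longrightarrow> (\<forall>k\<in>{..l}. avg (N s) (\<lambda>n. \<bar>F (J l) n - F (J k) n\<bar>) < \<delta> k)"
    by (intro allI eventually_sequentially_imp_of_large_values eventually_ball_finite ballI J0 J) auto
  then obtain P where P: "\<And>l s k. N s \<ge> P l \<Longrightarrow> k \<le> l \<Longrightarrow>
      avg (N s) (\<lambda>n. \<bar>F (J l) n - F (J k) n\<bar>) < \<delta> k"
    by (metis atMost_iff)
  \<comment> \<open>The summand \<open>Suc k * M k\<close> makes everything before
    \<open>M k\<close> negligible from \<open>M (Suc k)\<close> on, \<open>P (Suc k)\<close> puts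
    the estimates for the new member in force once its block begins, and \<open>1\<close> makes
    \<open>M\<close> strictly increasing.\<close>
  define M where "M = rec_nat (0::nat) (\<lambda>k m. Suc k * m + P (Suc k) + 1)"
  have M0: "M 0 = 0" and MS: "M (Suc k) = Suc k * M k + P (Suc k) + 1" for k
    by (simp_all add: M_def)
  have "strict_mono M"
    by (rule strict_mono_Suc_iff[THEN iffD2]) (simp add: MS)
  then have Mless: "M k < M l \<longleftrightarrow> k < l" and Mle: "M k \<le> M l \<longleftrightarrow> k \<le> l" for k l
    by (simp_all add: strict_mono_less strict_mono_less_eq)
  have Mk: "k \<le> M k" for k
    using \<open>strict_mono M\<close> by (rule strict_mono_imp_increasing)
  \<comment> \<open>The block containing \<open>n\<close>. The maximum exists since
    \<open>M 0 = 0\<close> and \<open>k \<le> M k\<close>.\<close>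
  define \<kappa> where "\<kappa> = (\<lambda>n. GREATEST k. M k \<le> n)"
  have \<kappa>: "M (\<kappa> n) \<le> n" "\<And>k. M k \<le> n \<Longrightarrow> k \<le> \<kappa> n" for n
  proof -
    have b: "\<And>y. M y \<le> n \<Longrightarrow> y \<le> n"
      using Mk le_trans by blast
    have "M 0 \<le> n" by (simp add: M0)
    then show "M (\<kappa> n) \<le> n"
      unfolding \<kappa>_def using b by (rule GreatestI_nat)
    show "\<And>k. M k \<le> n \<Longrightarrow> k \<le> \<kappa> n"
      unfolding \<kappa>_def using Greatest_le_nat[of "\<lambda>k. M k \<le> n"] b by blast
  qed
  define G where "G = (\<lambda>n. F (J (\<kappa> n)) n)"
  have G: "0 \<le> G n" "G n \<le> 1" for n
    using F by (auto simp: G_def)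
  \<comment> \<open>One \<open>\<delta> k\<close> for each of the last two blocks and one for all
    that precedes them. The offset \<open>2\<close> ensures \<open>m \<ge> 1\<close> below, as
    \<open>M 0 = 0\<close> need not dominate \<open>P 0\<close>.\<close>
  have main: "avg (N s) (\<lambda>n. \<bar>G n - F (J k) n\<bar>) \<le> 3 * \<delta> k" if "N s \<ge> M (k + 2)" for k s
  proof -
    define l where "l = \<kappa> (N s)"
    have l: "k + 2 \<le> l" using \<kappa>(2)[OF that] by (simp add: l_def)
    then obtain m where m: "l = Suc m" "Suc k \<le> m" by (cases l) auto
    have Ns: "M l \<le> N s" using \<kappa>(1) by (simp add: l_def)
    have Npos: "N s > 0" using Ns Mk[of l] m by simp
    have mpos: "P m \<le> M m" using m by (cases m) (auto simp: MS)
    have lpos: "P l \<le> M l" using m by (auto simp: MS)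
    have PN: "P m \<le> N s" "P l \<le> N s"
      using mpos lpos Ns Mle[of m l] m by auto
    \<comment> \<open>From \<open>M m\<close> on, \<open>G\<close> agrees with
      \<open>F (J m)\<close> or \<open>F (J l)\<close>, and the sum of both errors covers either
      case; before \<open>M m\<close> the trivial bound \<open>1\<close> is used.\<close>
    have pt: "\<bar>G n - F (J k) n\<bar> \<le> (if n < M m then 1 else 0)
        + (\<bar>F (J m) n - F (J k) n\<bar> + \<bar>F (J l) n - F (J k) n\<bar>)" if "n \<le> N s" for n
    proof (cases "n < M m")
      case True
      have "\<bar>G n - F (J k) n\<bar> \<le> 1"
        using G[of n] F[of "J k" n] by linarith
      with True show ?thesis by simp
    next
      case False
      then have "m \<le> \<kappa> n" using \<kappa>(2)[of m n] by simp
      moreover have "\<kappa> n \<le> l"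
        unfolding l_def using \<kappa>(1)[of n] that by (intro \<kappa>(2)) simp
      ultimately have "\<kappa> n = m \<or> \<kappa> n = l" using m by auto
      with False show ?thesis by (auto simp: G_def)
    qed
    have "avg (N s) (\<lambda>n. \<bar>G n - F (J k) n\<bar>) \<le> avg (N s) (\<lambda>n. (if n < M m then 1 else 0)
        + (\<bar>F (J m) n - F (J k) n\<bar> + \<bar>F (J l) n - F (J k) n\<bar>))"
      by (intro avg_mono pt)
    also have "\<dots> = avg (N s) (\<lambda>n. if n < M m then 1 else 0)
        + (avg (N s) (\<lambda>n. \<bar>F (J m) n - F (J k) n\<bar>) + avg (N s) (\<lambda>n. \<bar>F (J l) n - F (J k) n\<bar>))"
      by (simp only: avg_add)
    also have "\<dots> \<le> \<delta> k + (\<delta> k + \<delta> k)"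
    proof (intro add_mono)
      show "avg (N s) (\<lambda>n. \<bar>F (J m) n - F (J k) n\<bar>) \<le> \<delta> k"
        using P[OF PN(1), of k] m by simp
      show "avg (N s) (\<lambda>n. \<bar>F (J l) n - F (J k) n\<bar>) \<le> \<delta> k"
        using P[OF PN(2), of k] m by simp
      have "(\<Sum>n=1..N s. if n < M m then 1 else 0 :: real) = real (card {n\<in>{1..N s}. n < M m})"
        by (simp add: sum.If_cases Int_def)
      also have "card {n\<in>{1..N s}. n < M m} \<le> card {..<M m}"
        by (intro card_mono) auto
      finally have c: "(\<Sum>n=1..N s. if n < M m then 1 else 0 :: real) \<le> real (M m)" by simp
      \<comment> \<open>\<open>Suc m * M m\<close> is a summand of \<open>M l\<close>, and
        \<open>M l \<le> N s\<close>; so the early \<open>n\<close> have proportion at most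
        \<open>\<delta> k\<close>.\<close>
      have "Suc k * M m \<le> Suc m * M m"
        using m by (intro mult_right_mono) auto
      also have "\<dots> \<le> N s" using Ns by (simp add: m MS)
      finally have "real (Suc k) * real (M m) \<le> real (N s)"
        by (metis of_nat_le_iff of_nat_mult)
      then have "real (M m) / real (N s) \<le> \<delta> k"
        using Npos by (simp add: \<delta>_def field_simps)
      moreover have "avg (N s) (\<lambda>n. if n < M m then 1 else 0 :: real) \<le> real (M m) / real (N s)"
        using c by (simp add: avg_def divide_right_mono)
      ultimately show "avg (N s) (\<lambda>n. if n < M m then 1 else 0) \<le> \<delta> k" by simp
    qed
    finally show ?thesis by simp
  qed
  have "\<exists>J. \<forall>j\<ge>J. \<forall>\<^sub>F s in sequentially. avg (N s) (\<lambda>n. \<bar>G n - F j n\<bar>) < \<epsilon>" if \<epsilon>: "\<epsilon> > 0" for \<epsilon>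
  proof -
    \<comment> \<open>The quarter: \<open>main\<close> costs \<open>3 * \<delta> k\<close>, and
      passing from \<open>F (J k)\<close> to \<open>F j\<close> costs one more
      \<open>\<delta> k\<close>.\<close>
    obtain k where k: "\<delta> k < \<epsilon> / 4"
      using reals_Archimedean[of "\<epsilon> / 4"] \<epsilon> by (auto simp: \<delta>_def inverse_eq_divide)
    show ?thesis
    proof (intro exI[of _ "J0 k"] allI impI)
      fix j assume "j \<ge> J0 k"
      then have 1: "\<forall>\<^sub>F s in sequentially. avg (N s) (\<lambda>n. \<bar>F (J k) n - F j n\<bar>) < \<delta> k"
        by (intro J0 J) auto
      have 2: "\<forall>\<^sub>F s in sequentially. N s \<ge> M (k + 2)"
        using N by (simp add: filterlim_at_top)
      from 1 2 show "\<forall>\<^sub>F s in sequentially. avg (N s) (\<lambda>n. \<bar>G n - F j n\<bar>) < \<epsilon>"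
      proof eventually_elim
        case (elim s)
        have "avg (N s) (\<lambda>n. \<bar>G n - F j n\<bar>)
            \<le> avg (N s) (\<lambda>n. \<bar>G n - F (J k) n\<bar> + \<bar>F (J k) n - F j n\<bar>)"
          by (intro avg_mono) linarith
        also have "\<dots> = avg (N s) (\<lambda>n. \<bar>G n - F (J k) n\<bar>) + avg (N s) (\<lambda>n. \<bar>F (J k) n - F j n\<bar>)"
          by (rule avg_add)
        also have "\<dots> < 4 * \<delta> k" using main[OF elim(2)] elim(1) by linarith
        finally show ?case using k by simp
      qed
    qed
  qed
  then show ?thesis using G by blast
qed

subsection \<open>Invariant and ergodic sequences\<close>

text \<open>Triangle inequality through the window averages at \<open>n + 1\<close> and
  \<open>n\<close>: two approximation errors, whose means asymptotically agree by shift invariance,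
  and the change \<open>2 / H\<close> of a window average under a unit shift.\<close>

lemma invariant_in_mean_if_limit_of_shifted_avgs:
  fixes f G :: "nat \<Rightarrow> real"
  assumes N: "filterlim N at_top sequentially"
    and f: "\<And>n. 0 \<le> f n" "\<And>n. f n \<le> 1"
    and G: "\<And>n. 0 \<le> G n" "\<And>n. G n \<le> 1"
    and lim: "\<And>\<epsilon>. \<epsilon> > 0 \<Longrightarrow>
      \<exists>J. \<forall>H\<ge>J. \<forall>\<^sub>F s in sequentially. avg (N s) (\<lambda>n. \<bar>G n - avg H (\<lambda>h. f (n + h))\<bar>) < \<epsilon>"
  shows "(\<lambda>s. avg (N s) (\<lambda>n. \<bar>G (n + 1) - G n\<bar>)) \<longlonglongrightarrow> 0"
proof (rule tendsto_0_if_eventually_less)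
  fix \<epsilon> :: real assume \<epsilon>: "\<epsilon> > 0"
  obtain J where J: "\<And>H. H \<ge> J \<Longrightarrow>
      \<forall>\<^sub>F s in sequentially. avg (N s) (\<lambda>n. \<bar>G n - avg H (\<lambda>h. f (n + h))\<bar>) < \<epsilon> / 4"
    using lim[of "\<epsilon> / 4"] \<epsilon> by auto
  obtain m where m: "2 / real (Suc m) < \<epsilon> / 4"
    using reals_Archimedean[of "\<epsilon> / 8"] \<epsilon> by (auto simp: field_simps)
  \<comment> \<open>Large enough both for the approximation (\<open>H \<ge> J\<close>) and for
    \<open>2 / H < \<epsilon> / 4\<close>.\<close>
  define H where "H = Suc m + J"
  have "2 / real H \<le> 2 / real (Suc m)"
    by (intro divide_left_mono) (auto simp: H_def)
  with m have H: "H \<ge> J" "H > 0" "2 / real H < \<epsilon> / 4"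
    by (auto simp: H_def)
  define A where "A = (\<lambda>n. avg H (\<lambda>h. f (n + h)))"
  define D where "D = (\<lambda>n. \<bar>G n - A n\<bar>)"
  have A: "0 \<le> A n" "A n \<le> 1" for n
    unfolding A_def using f H by (auto intro!: avg_nonneg avg_le_const)
  have D: "\<bar>D n\<bar> \<le> 1" for n
    using A[of n] G[of n] by (simp add: D_def abs_le_iff)
  have A1: "\<bar>A (n + 1) - A n\<bar> \<le> 2 / real H" for n
    using abs_avg_shift_le[of "\<lambda>h. f (n + h)" 1 H 1] f by (simp add: A_def)
  have 1: "\<forall>\<^sub>F s in sequentially. avg (N s) D < \<epsilon> / 4"
    using J[OF H(1)] by (simp add: D_def A_def)
  have 2: "\<forall>\<^sub>F s in sequentially. \<bar>avg (N s) (\<lambda>n. D (n + 1)) - avg (N s) D\<bar> < \<epsilon> / 4"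
    using \<epsilon> by (intro eventually_abs_less avg_shift_tendsto_0[OF N D]) auto
  have 3: "\<forall>\<^sub>F s in sequentially. N s \<ge> 1"
    using N by (simp add: filterlim_at_top)
  from 1 2 3 show "\<forall>\<^sub>F s in sequentially. \<bar>avg (N s) (\<lambda>n. \<bar>G (n + 1) - G n\<bar>)\<bar> < \<epsilon>"
  proof eventually_elim
    case (elim s)
    have "avg (N s) (\<lambda>n. \<bar>G (n + 1) - G n\<bar>) \<le> avg (N s) (\<lambda>n. D (n + 1) + D n + 2 / real H)"
    proof (rule avg_mono)
      fix n show "\<bar>G (n + 1) - G n\<bar> \<le> D (n + 1) + D n + 2 / real H"
        using A1[of n] unfolding D_def by linarith
    qed
    also have "\<dots> = avg (N s) (\<lambda>n. D (n + 1)) + avg (N s) D + 2 / real H"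
      using elim(3) by (simp only: avg_add) (simp add: avg_const)
    also have "\<dots> < \<epsilon>" using elim H(3) by linarith
    finally show ?case
      using avg_nonneg[of "\<lambda>n. \<bar>G (n + 1) - G n\<bar>" "N s"] by simp
  qed
qed

text \<open>A shift by \<open>h\<close> is a chain of unit steps, and the mean of each step tends to
  \<open>0\<close> like that of the first.\<close>

lemma invariant_in_mean_shift:
  fixes G :: "nat \<Rightarrow> real"
  assumes N: "filterlim N at_top sequentially" and G: "\<And>n. \<bar>G n\<bar> \<le> B"
    and inv: "(\<lambda>s. avg (N s) (\<lambda>n. \<bar>G (n + 1) - G n\<bar>)) \<longlonglongrightarrow> 0"
  shows "(\<lambda>s. avg (N s) (\<lambda>n. \<bar>G (n + h) - G n\<bar>)) \<longlonglongrightarrow> 0"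
proof (induction h)
  case 0
  then show ?case by (simp add: avg_def)
next
  case (Suc h)
  define D where "D = (\<lambda>n. \<bar>G (n + 1) - G n\<bar>)"
  have D: "\<bar>D n\<bar> \<le> 2 * B" for n
    using G[of "n + 1"] G[of n] unfolding D_def by linarith
  have "(\<lambda>s. (avg (N s) (\<lambda>n. D (n + h)) - avg (N s) D) + avg (N s) D
      + avg (N s) (\<lambda>n. \<bar>G (n + h) - G n\<bar>)) \<longlonglongrightarrow> 0 + 0 + 0"
    by (intro tendsto_add avg_shift_tendsto_0[OF N D] Suc) (use inv in \<open>simp add: D_def\<close>)
  then have lim: "(\<lambda>s. avg (N s) (\<lambda>n. D (n + h)) + avg (N s) (\<lambda>n. \<bar>G (n + h) - G n\<bar>)) \<longlonglongrightarrow> 0"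
    by simp
  show ?case
  proof (rule Lim_null_comparison[OF _ lim], intro always_eventually allI)
    fix s
    have "avg (N s) (\<lambda>n. \<bar>G (n + Suc h) - G n\<bar>)
        \<le> avg (N s) (\<lambda>n. D (n + h) + \<bar>G (n + h) - G n\<bar>)"
      by (intro avg_mono) (simp add: D_def)
    then show "norm (avg (N s) (\<lambda>n. \<bar>G (n + Suc h) - G n\<bar>))
        \<le> avg (N s) (\<lambda>n. D (n + h)) + avg (N s) (\<lambda>n. \<bar>G (n + h) - G n\<bar>)"
      using avg_nonneg[of "\<lambda>n. \<bar>G (n + Suc h) - G n\<bar>" "N s"] by (simp add: avg_add)
  qed
qed

text \<open>The window average of \<open>f - G\<close> splits into the approximation error of
  \<open>G n\<close> and the window average of \<open>G (n + h) - G n\<close>, which is small by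
  invariance for each fixed \<open>H\<close>.\<close>

lemma ergodic_in_mean_diff:
  fixes f G :: "nat \<Rightarrow> real"
  assumes inv: "\<And>h. (\<lambda>s. avg (N s) (\<lambda>n. \<bar>G (n + h) - G n\<bar>)) \<longlonglongrightarrow> 0"
    and lim: "\<And>\<epsilon>. \<epsilon> > 0 \<Longrightarrow>
      \<exists>J. \<forall>H\<ge>J. \<forall>\<^sub>F s in sequentially. avg (N s) (\<lambda>n. \<bar>G n - avg H (\<lambda>h. f (n + h))\<bar>) < \<epsilon>"
    and \<epsilon>: "\<epsilon> > 0"
  shows "\<exists>J. \<forall>H\<ge>J. \<forall>\<^sub>F s in sequentially.
    avg (N s) (\<lambda>n. \<bar>avg H (\<lambda>h. f (n + h) - G (n + h))\<bar>) < \<epsilon>"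
proof -
  obtain J where J: "\<And>H. H \<ge> J \<Longrightarrow>
      \<forall>\<^sub>F s in sequentially. avg (N s) (\<lambda>n. \<bar>G n - avg H (\<lambda>h. f (n + h))\<bar>) < \<epsilon> / 2"
    using lim[of "\<epsilon> / 2"] \<epsilon> by auto
  show ?thesis
  \<comment> \<open>\<open>Suc J\<close> keeps \<open>H\<close> positive, so that the constant
    \<open>G n\<close> is its own average over \<open>h\<close>.\<close>
  proof (intro exI[of _ "Suc J"] allI impI)
    fix H assume H: "H \<ge> Suc J"
    have "(\<lambda>s. avg H (\<lambda>h. avg (N s) (\<lambda>n. \<bar>G (n + h) - G n\<bar>))) \<longlonglongrightarrow> avg H (\<lambda>h. 0)"
      by (intro tendsto_avg inv)
    then have "(\<lambda>s. avg H (\<lambda>h. avg (N s) (\<lambda>n. \<bar>G (n + h) - G n\<bar>))) \<longlonglongrightarrow> 0"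
      by (simp add: avg_def)
    then have 1: "\<forall>\<^sub>F s in sequentially. \<bar>avg H (\<lambda>h. avg (N s) (\<lambda>n. \<bar>G (n + h) - G n\<bar>))\<bar> < \<epsilon> / 2"
      using \<epsilon> by (intro eventually_abs_less) auto
    have 2: "\<forall>\<^sub>F s in sequentially. avg (N s) (\<lambda>n. \<bar>G n - avg H (\<lambda>h. f (n + h))\<bar>) < \<epsilon> / 2"
      using J H by simp
    from 1 2 show "\<forall>\<^sub>F s in sequentially.
        avg (N s) (\<lambda>n. \<bar>avg H (\<lambda>h. f (n + h) - G (n + h))\<bar>) < \<epsilon>"
    proof eventually_elim
      case (elim s)
      have pt: "\<bar>avg H (\<lambda>h. f (n + h) - G (n + h))\<bar>
          \<le> \<bar>G n - avg H (\<lambda>h. f (n + h))\<bar> + avg H (\<lambda>h. \<bar>G (n + h) - G n\<bar>)" for n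
      proof -
        have "\<bar>avg H (\<lambda>h. G (n + h) - G n)\<bar> \<le> avg H (\<lambda>h. \<bar>G (n + h) - G n\<bar>)"
          by (rule abs_avg_le)
        moreover have "avg H (\<lambda>h. G (n + h) - G n) = avg H (\<lambda>h. G (n + h)) - G n"
          using H by (simp add: avg_diff avg_const)
        ultimately show ?thesis by (simp add: avg_diff)
      qed
      have "avg (N s) (\<lambda>n. \<bar>avg H (\<lambda>h. f (n + h) - G (n + h))\<bar>)
          \<le> avg (N s) (\<lambda>n. \<bar>G n - avg H (\<lambda>h. f (n + h))\<bar> + avg H (\<lambda>h. \<bar>G (n + h) - G n\<bar>))"
        by (intro avg_mono pt)
      also have "\<dots> = avg (N s) (\<lambda>n. \<bar>G n - avg H (\<lambda>h. f (n + h))\<bar>)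
          + avg H (\<lambda>h. avg (N s) (\<lambda>n. \<bar>G (n + h) - G n\<bar>))"
        by (simp only: avg_add avg_swap[of _ H])
      also have "\<dots> < \<epsilon>" using elim by linarith
      finally show ?case .
    qed
  qed
qed

text \<open>The product is replaced by its window averages, in which \<open>g (n + h)\<close> is
  frozen to \<open>g n\<close> by invariance; what remains is \<open>g n\<close> times a window
  average of \<open>e\<close>. Each of the three errors takes \<open>\<epsilon> / 3\<close>.\<close>

lemma mean_invariant_mult_ergodic_tendsto_0:
  fixes g e :: "nat \<Rightarrow> real"
  assumes N: "filterlim N at_top sequentially"
    and g: "\<And>n. \<bar>g n\<bar> \<le> 1" and e: "\<And>n. \<bar>e n\<bar> \<le> 1"
    and inv: "\<And>h. (\<lambda>s. avg (N s) (\<lambda>n. \<bar>g (n + h) - g n\<bar>)) \<longlonglongrightarrow> 0"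
    and erg: "\<And>\<epsilon>. \<epsilon> > 0 \<Longrightarrow>
      \<exists>J. \<forall>H\<ge>J. \<forall>\<^sub>F s in sequentially. avg (N s) (\<lambda>n. \<bar>avg H (\<lambda>h. e (n + h))\<bar>) < \<epsilon>"
  shows "(\<lambda>s. avg (N s) (\<lambda>n. g n * e n)) \<longlonglongrightarrow> 0"
proof (rule tendsto_0_if_eventually_less)
  fix \<epsilon> :: real assume \<epsilon>: "\<epsilon> > 0"
  obtain J where J: "\<And>H. H \<ge> J \<Longrightarrow>
      \<forall>\<^sub>F s in sequentially. avg (N s) (\<lambda>n. \<bar>avg H (\<lambda>h. e (n + h))\<bar>) < \<epsilon> / 3"
    using erg[of "\<epsilon> / 3"] \<epsilon> by auto
  define H where "H = Suc J"
  have H: "H > 0" by (simp add: H_def)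
  have ge: "\<bar>g n * e n\<bar> \<le> 1" for n
    using mult_mono[OF g[of n] e[of n]] by (simp add: abs_mult)
  have 1: "\<forall>\<^sub>F s in sequentially. avg (N s) (\<lambda>n. \<bar>avg H (\<lambda>h. e (n + h))\<bar>) < \<epsilon> / 3"
    by (rule J) (simp add: H_def)
  have "(\<lambda>s. avg H (\<lambda>h. avg (N s) (\<lambda>n. \<bar>g (n + h) - g n\<bar>))) \<longlonglongrightarrow> avg H (\<lambda>h. 0)"
    by (intro tendsto_avg inv)
  then have "(\<lambda>s. avg H (\<lambda>h. avg (N s) (\<lambda>n. \<bar>g (n + h) - g n\<bar>))) \<longlonglongrightarrow> 0"
    by (simp add: avg_def)
  then have 2: "\<forall>\<^sub>F s in sequentially. \<bar>avg H (\<lambda>h. avg (N s) (\<lambda>n. \<bar>g (n + h) - g n\<bar>))\<bar> < \<epsilon> / 3"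
    using \<epsilon> by (intro eventually_abs_less) auto
  have 3: "\<forall>\<^sub>F s in sequentially. \<bar>avg (N s) (\<lambda>n. avg H (\<lambda>h. g (n + h) * e (n + h)))
      - avg (N s) (\<lambda>n. g n * e n)\<bar> < \<epsilon> / 3"
    using \<epsilon> by (intro eventually_abs_less avg_avg_shift_tendsto_0[OF N ge H]) auto
  from 1 2 3 show "\<forall>\<^sub>F s in sequentially. \<bar>avg (N s) (\<lambda>n. g n * e n)\<bar> < \<epsilon>"
  proof eventually_elim
    case (elim s)
    have pt: "\<bar>avg H (\<lambda>h. g (n + h) * e (n + h))\<bar>
        \<le> avg H (\<lambda>h. \<bar>g (n + h) - g n\<bar>) + \<bar>avg H (\<lambda>h. e (n + h))\<bar>" for n
    proof -
      have "avg H (\<lambda>h. g (n + h) * e (n + h))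
          = avg H (\<lambda>h. (g (n + h) - g n) * e (n + h) + g n * e (n + h))"
        by (simp add: algebra_simps)
      also have "\<dots> = avg H (\<lambda>h. (g (n + h) - g n) * e (n + h)) + g n * avg H (\<lambda>h. e (n + h))"
        by (simp only: avg_add avg_cmult)
      finally have eq: "avg H (\<lambda>h. g (n + h) * e (n + h))
          = avg H (\<lambda>h. (g (n + h) - g n) * e (n + h)) + g n * avg H (\<lambda>h. e (n + h))" .
      have "\<bar>avg H (\<lambda>h. (g (n + h) - g n) * e (n + h))\<bar>
          \<le> avg H (\<lambda>h. \<bar>(g (n + h) - g n) * e (n + h)\<bar>)"
        by (rule abs_avg_le)
      also have "\<dots> \<le> avg H (\<lambda>h. \<bar>g (n + h) - g n\<bar>)"
        using e by (intro avg_mono) (simp add: abs_mult mult_left_le)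
      moreover have "\<bar>g n * avg H (\<lambda>h. e (n + h))\<bar> \<le> \<bar>avg H (\<lambda>h. e (n + h))\<bar>"
        using g by (simp add: abs_mult mult_left_le_one_le)
      ultimately show ?thesis unfolding eq by linarith
    qed
    have "\<bar>avg (N s) (\<lambda>n. avg H (\<lambda>h. g (n + h) * e (n + h)))\<bar>
        \<le> avg (N s) (\<lambda>n. \<bar>avg H (\<lambda>h. g (n + h) * e (n + h))\<bar>)"
      by (rule abs_avg_le)
    also have "\<dots> \<le> avg (N s) (\<lambda>n. avg H (\<lambda>h. \<bar>g (n + h) - g n\<bar>) + \<bar>avg H (\<lambda>h. e (n + h))\<bar>)"
      by (intro avg_mono pt)
    also have "\<dots> = avg H (\<lambda>h. avg (N s) (\<lambda>n. \<bar>g (n + h) - g n\<bar>))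
        + avg (N s) (\<lambda>n. \<bar>avg H (\<lambda>h. e (n + h))\<bar>)"
      by (simp only: avg_add avg_swap[of _ H])
    finally show ?case using elim by linarith
  qed
qed

subsection \<open>The decomposition\<close>

text \<open>The case of two factors without conjugation. The shifts are natural numbers, so for
  \<open>n \<ge> 1\<close> the arguments are positive and the extension by \<open>0\<close> never
  intervenes.\<close>

lemma convergent_real_correlation:
  assumes "admits_correlations N (\<lambda>n. complex_of_real (f n))"
  shows "convergent (\<lambda>s. avg (N s) (\<lambda>n. f (n + a) * f (n + b)))"
proof -
  define h where "h = (\<lambda>i::nat. if i = 1 then int a else int b)"
  have "convergent (\<lambda>s. avg (N s) (\<lambda>n. \<Prod>i=1..2.
      (cnj ^^ 0) (zext (\<lambda>n. complex_of_real (f n)) (int n + h i))))"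
    using assms[unfolded admits_correlations_def, THEN conjunct2, rule_format, of 2 "\<lambda>_. 0" h] by simp
  also have "(\<lambda>s. avg (N s) (\<lambda>n. \<Prod>i=1..2.
      (cnj ^^ 0) (zext (\<lambda>n. complex_of_real (f n)) (int n + h i))))
      = (\<lambda>s. complex_of_real (avg (N s) (\<lambda>n. f (n + a) * f (n + b))))"
    by (subst avg_of_real[symmetric], intro ext avg_cong)
      (auto simp: numeral_2_eq_2 zext_def h_def nat_add_distrib)
  finally show ?thesis
    by (auto simp: convergent_def dest!: tendsto_Re)
qed

lemma bounded_seq_of_real:
  assumes "\<And>n. n \<ge> 1 \<Longrightarrow> \<bar>a n\<bar> \<le> B"
  shows "bounded_seq (\<lambda>n. complex_of_real (a n))"
  unfolding bounded_seq_def bounded_iff using assms by (auto intro!: exI[of _ B])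

lemma locally_invariant_of_real:
  assumes "\<And>n. n \<ge> 1 \<Longrightarrow> \<bar>g n\<bar> \<le> B"
    and "(\<lambda>s. avg (N s) (\<lambda>n. \<bar>g (n + 1) - g n\<bar>)) \<longlonglongrightarrow> 0"
  shows "locally_invariant N (\<lambda>n. complex_of_real (g n))"
proof -
  have "(\<lambda>s. ereal (avg (N s) (\<lambda>n. \<bar>g (n + 1) - g n\<bar>))) \<longlonglongrightarrow> ereal 0"
    using assms(2) by (rule tendsto_ereal)
  then have "limsup (\<lambda>s. ereal (avg (N s) (\<lambda>n. \<bar>g (n + 1) - g n\<bar>))) = ereal 0"
    by (intro lim_imp_Limsup) auto
  then show ?thesis
    unfolding locally_invariant_def using bounded_seq_of_real[OF assms(1)]
    by (simp flip: of_real_diff add: zero_ereal_def)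
qed

text \<open>For \<open>H \<ge> J\<close> the inner limsup lies between \<open>0\<close> and
  \<open>\<epsilon>\<close>, which squeezes the outer one.\<close>

lemma locally_ergodic_of_real:
  assumes "\<And>n. n \<ge> 1 \<Longrightarrow> \<bar>e n\<bar> \<le> B"
    and erg: "\<And>\<epsilon>. \<epsilon> > 0 \<Longrightarrow>
      \<exists>J. \<forall>H\<ge>J. \<forall>\<^sub>F s in sequentially. avg (N s) (\<lambda>n. \<bar>avg H (\<lambda>h. e (n + h))\<bar>) < \<epsilon>"
  shows "locally_ergodic N (\<lambda>n. complex_of_real (e n))"
proof -
  define L where "L = (\<lambda>H. limsup (\<lambda>s. ereal (avg (N s) (\<lambda>n. \<bar>avg H (\<lambda>h. e (n + h))\<bar>))))"
  have "0 \<le> L H" for H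
    unfolding L_def by (intro le_Limsup always_eventually allI) (auto intro!: avg_nonneg)
  then have lower: "0 \<le> limsup L"
    by (intro le_Limsup always_eventually allI) auto
  have upper: "limsup L \<le> 0 + ereal \<epsilon>" if \<epsilon>: "\<epsilon> > 0" for \<epsilon>
  proof -
    obtain J where J: "\<And>H. H \<ge> J \<Longrightarrow>
        \<forall>\<^sub>F s in sequentially. avg (N s) (\<lambda>n. \<bar>avg H (\<lambda>h. e (n + h))\<bar>) < \<epsilon>"
      using erg[OF \<epsilon>] by auto
    have "L H \<le> ereal \<epsilon>" if "H \<ge> J" for H
      unfolding L_def using J[OF that] by (intro Limsup_bounded) (auto elim: eventually_mono)
    then show ?thesis
      by (intro Limsup_bounded) (auto simp: eventually_sequentially)
  qed
  have "limsup L \<le> 0"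
    using upper by (rule ereal_le_epsilon2)
  with lower have "limsup L = 0"
    by (rule antisym[rotated])
  then show ?thesis
    unfolding locally_ergodic_def L_def using bounded_seq_of_real[OF assms(1)]
    by (simp add: avg_of_real)
qed

theorem theorem7p11:
  fixes f :: "nat \<Rightarrow> real" and N :: "nat \<Rightarrow> nat"
  assumes "\<forall>n\<ge>1. 0 \<le> f n \<and> f n \<le> 1"
    and "filterlim N at_top sequentially"
    and "admits_correlations N (\<lambda>n. complex_of_real (f n))"
  shows "\<exists>f_inv f_erg :: nat \<Rightarrow> real.
      (\<forall>n\<ge>1. f n = f_inv n + f_erg n) \<and>
      (\<forall>n\<ge>1. 0 \<le> f_inv n \<and> f_inv n \<le> 1) \<and>
      has_mean_along N (\<lambda>n. complex_of_real (f_erg n)) 0 \<and>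
      locally_invariant N (\<lambda>n. complex_of_real (f_inv n)) \<and>
      locally_ergodic N (\<lambda>n. complex_of_real (f_erg n)) \<and>
      has_inner_along N (\<lambda>n. complex_of_real (f_inv n)) (\<lambda>n. complex_of_real (f_erg n)) 0"
proof -
  note N = assms(2)
  \<comment> \<open>The bounds on \<open>f\<close> hold from \<open>1\<close> on only; resetting the
    value at \<open>0\<close> makes them hold everywhere and changes none of the averages.\<close>
  define f' where "f' = (\<lambda>n. if n = 0 then 0 else f n)"
  have f': "0 \<le> f' n" "f' n \<le> 1" for n
    using assms(1) by (auto simp: f'_def)
  have conv: "convergent (\<lambda>s. avg (N s) (\<lambda>n. f' (n + a) * f' (n + b)))" for a b
  proof -
    have "avg M (\<lambda>n. f' (n + a) * f' (n + b)) = avg M (\<lambda>n. f (n + a) * f (n + b))" for M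
      by (rule avg_cong) (simp add: f'_def)
    then show ?thesis
      using convergent_real_correlation[OF assms(3)] by simp
  qed
  define A where "A = (\<lambda>H n. avg H (\<lambda>h. f' (n + h)))"
  have A: "0 \<le> A H n" "A H n \<le> 1" for H n
  proof -
    show "0 \<le> A H n"
      unfolding A_def using f' by (intro avg_nonneg) auto
    show "A H n \<le> 1"
      unfolding A_def using f' by (intro avg_le_one) auto
  qed
  have "\<exists>G. (\<forall>n. 0 \<le> G n \<and> G n \<le> 1) \<and>
    (\<forall>\<epsilon>>0. \<exists>J. \<forall>j\<ge>J. \<forall>\<^sub>F s in sequentially. avg (N s) (\<lambda>n. \<bar>G n - A j n\<bar>) < \<epsilon>)"
  proof (rule complete_in_mean[OF N A])
    fix \<epsilon> :: real assume "\<epsilon> > 0"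
    then show "\<exists>J. \<forall>i\<ge>J. \<forall>j\<ge>J. \<forall>\<^sub>F s in sequentially. avg (N s) (\<lambda>n. \<bar>A i n - A j n\<bar>) < \<epsilon>"
      using shifted_avg_Cauchy_in_mean[OF N f' conv] unfolding A_def by blast
  qed
  then obtain G where G: "\<And>n. 0 \<le> G n" "\<And>n. G n \<le> 1"
    and lim: "\<And>\<epsilon>. \<epsilon> > 0 \<Longrightarrow> \<exists>J. \<forall>H\<ge>J. \<forall>\<^sub>F s in sequentially.
      avg (N s) (\<lambda>n. \<bar>G n - avg H (\<lambda>h. f' (n + h))\<bar>) < \<epsilon>"
    unfolding A_def by blast
  define e where "e = (\<lambda>n. f' n - G n)"
  have G1: "\<bar>G n\<bar> \<le> 1" and e1: "\<bar>e n\<bar> \<le> 1" for n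
    using G[of n] f'[of n] by (auto simp: e_def)
  have inv1: "(\<lambda>s. avg (N s) (\<lambda>n. \<bar>G (n + 1) - G n\<bar>)) \<longlonglongrightarrow> 0"
    by (rule invariant_in_mean_if_limit_of_shifted_avgs[OF N f' G lim])
  have inv: "(\<lambda>s. avg (N s) (\<lambda>n. \<bar>G (n + h) - G n\<bar>)) \<longlonglongrightarrow> 0" for h
    by (rule invariant_in_mean_shift[OF N G1 inv1])
  have erg: "\<exists>J. \<forall>H\<ge>J. \<forall>\<^sub>F s in sequentially. avg (N s) (\<lambda>n. \<bar>avg H (\<lambda>h. e (n + h))\<bar>) < \<epsilon>"
    if "\<epsilon> > 0" for \<epsilon>
    unfolding e_def by (rule ergodic_in_mean_diff[OF inv lim that])
  \<comment> \<open>The zero mean is orthogonality to the constant \<open>1\<close>, which is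
    trivially invariant.\<close>
  have "(\<lambda>s. avg (N s) (\<lambda>n. 1 * e n)) \<longlonglongrightarrow> 0"
    by (rule mean_invariant_mult_ergodic_tendsto_0[OF N _ e1 _ erg]) (auto simp: avg_def)
  from tendsto_of_real[OF this]
  have mean: "has_mean_along N (\<lambda>n. complex_of_real (e n)) 0"
    by (simp add: has_mean_along_def avg_of_real)
  \<comment> \<open>Conjugation fixes real values, so the inner product is this real mean.\<close>
  have "(\<lambda>s. avg (N s) (\<lambda>n. G n * e n)) \<longlonglongrightarrow> 0"
    by (rule mean_invariant_mult_ergodic_tendsto_0[OF N G1 e1 inv erg])
  from tendsto_of_real[OF this]
  have inner: "has_inner_along N (\<lambda>n. complex_of_real (G n)) (\<lambda>n. complex_of_real (e n)) 0"
    by (simp add: has_inner_along_def has_mean_along_def avg_of_real flip: of_real_mult)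
  have "locally_invariant N (\<lambda>n. complex_of_real (G n))"
    using G1 inv1 by (rule locally_invariant_of_real)
  moreover have "locally_ergodic N (\<lambda>n. complex_of_real (e n))"
    using e1 erg by (rule locally_ergodic_of_real)
  moreover have "\<forall>n\<ge>1. f n = G n + e n"
    by (simp add: e_def f'_def)
  ultimately show ?thesis
    using mean inner G by blast
qed

end
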